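(* For every integer $n\ge 0$, the optimal interior weights of the unit interval satisfy $$\overline M_{[0,1]}^{2n}=\overline M_{[0,1]}^{2n+1}=\overline W^{-1}:=\frac{(n+1)(n+2)}{2}.$$ The optimal boundary-weighted quadrature is the Gauss--Lobatto quadrature with $n$ interior points and end weight $\overline W$; i.e. with $x_1,\dots,x_n\in(0,1)$ the interior Gauss--Lobatto points there are positive weights $\hat w_i$ such that $2\int_0^1U=\overline W\,(U(0)+U(1))+\sum_{i=1}^n\hat w_iU(x_i)$ for all polynomials $U$ of degree at most $2n+1$.
   Context: $\overline M_{[0,1]}^{k}:=\sup\bigl\{\frac{(U(0)+U(1))/2}{\int_0^1U}\bigr\}$, the supremum being over real polynomials $U$ of one variable of degree at most $k$ with $U\ge0$ on $[0,1]$ and $\int_0^1U>0$. A boundary-weighted quadrature rule is one of the form $\int_0^1U=\sum_iw_iU(x_i)+\overline W\,\frac{U(0)+U(1)}{2}$ with $w_i\ge0$, $x_i\in[0,1]$, exact for the representation space; it is optimal if $\overline W^{-1}$ equals the optimal interior weight. *)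

theory Defs
  imports "HOL-Analysis.Analysis" "HOL-Computational_Algebra.Polynomial"
begin

text \<open>
  The supremum is taken in the extended reals, so that an equation between it and a real number
  includes the boundedness of the set of quotients.
\<close>

definition optimal_interior_weight :: "nat \<Rightarrow> ereal" where
  "optimal_interior_weight k =
     Sup {ereal (((poly U 0 + poly U 1) / 2) / integral {0..1} (poly U)) | U :: real poly.
            degree U \<le> k \<and> (\<forall>x\<in>{0..1}. 0 \<le> poly U x) \<and> 0 < integral {0..1} (poly U)}"

text \<open>
  A rule is given by its finite set \<open>X\<close> of nodes, the weight \<open>w x\<close> of each node \<open>x\<close>, and the
  boundary weight \<open>W\<close>; a node listed several times is listed once with its weights added.
  The end points may occur as nodes, and weights may vanish.
\<close>

definition boundary_weighted_rule :: "nat \<Rightarrow> real set \<Rightarrow> (real \<Rightarrow> real) \<Rightarrow> real \<Rightarrow> bool" where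
  "boundary_weighted_rule k X w W \<longleftrightarrow>
     finite X \<and> X \<subseteq> {0..1} \<and> (\<forall>x\<in>X. 0 \<le> w x) \<and>
     (\<forall>U :: real poly. degree U \<le> k \<longrightarrow>
        integral {0..1} (poly U) = (\<Sum>x\<in>X. w x * poly U x) + W * ((poly U 0 + poly U 1) / 2))"

definition optimal_boundary_weighted_rule ::
    "nat \<Rightarrow> real set \<Rightarrow> (real \<Rightarrow> real) \<Rightarrow> real \<Rightarrow> bool" where
  "optimal_boundary_weighted_rule k X w W \<longleftrightarrow>
     boundary_weighted_rule k X w W \<and> ereal (inverse W) = optimal_interior_weight k"

text \<open>Rodrigues' formula: \<open>P\<^sub>m(t) = 1 / (2\<^sup>m m!) \<cdot> d\<^sup>m/dt\<^sup>m (t\<^sup>2 - 1)\<^sup>m\<close>.\<close>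

definition legendre_poly :: "nat \<Rightarrow> real poly" where
  "legendre_poly m = smult (1 / (2 ^ m * fact m)) ((pderiv ^^ m) ([:-1, 0, 1:] ^ m))"

text \<open>
  The \<open>n\<close> interior nodes of the Gauss--Lobatto quadrature with \<open>n + 2\<close> nodes are the zeros of the
  derivative of the Legendre polynomial \<open>P\<^sub>n\<^sub>+\<^sub>1\<close>, transported from \<open>[-1, 1]\<close> to \<open>[0, 1]\<close>.
\<close>

definition gauss_lobatto_interior_points :: "nat \<Rightarrow> real set" where
  "gauss_lobatto_interior_points n =
     {(1 + t) / 2 | t. poly (pderiv (legendre_poly (n + 1))) t = 0}"

definition gauss_lobatto_end_weight :: "nat \<Rightarrow> real" where
  "gauss_lobatto_end_weight n = inverse ((real n + 1) * (real n + 2) / 2)"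

end

theory Submission
  imports Defs
begin

text \<open>
  A quadrature rule with nonnegative interior weights bounds \<open>(U(0) + U(1)) / 2\<close> by
  \<open>W\<^sup>-\<^sup>1 \<integral>U\<close> for every \<open>U \<ge> 0\<close> of the degrees that it integrates exactly: the interior nodes
  only add to the integral.  Equality holds precisely when \<open>U\<close> vanishes at all nodes of positive
  weight.  If the rule has \<open>n\<close> nodes in \<open>(0, 1)\<close> and is exact up to degree \<open>2n\<close>, then the square
  \<open>L\<^sup>2\<close> of the polynomial of degree \<open>n\<close> that vanishes at the nodes is an admissible \<open>U\<close>, so the
  bound is attained and the optimal weight is \<open>W\<^sup>-\<^sup>1\<close>.  The same polynomial gives uniqueness: another
  rule with the same boundary weight must give \<open>L\<^sup>2\<close> the interior sum zero, so it lives on the same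
  nodes, and the Lagrange basis polynomials at the nodes then read off its weights
  (\<open>positive_rule_is_optimal\<close>).

  It remains to see that the Gauss--Lobatto rule is such a rule, with boundary weight
  \<open>2 / ((n + 1) (n + 2))\<close>.  On \<open>[-1, 1]\<close>, with \<open>m = n + 1\<close>, let \<open>P\<close> be the \<open>m\<close>-th derivative of
  \<open>(t\<^sup>2 - 1)\<^sup>m\<close>, a multiple of the Legendre polynomial.  Iterating Rolle's theorem gives \<open>P\<close> a full
  set of zeros in \<open>(-1, 1)\<close>, and \<open>P'\<close> as well (\<open>lobatto_zeros\<close>).  Repeated integration by parts
  makes \<open>P\<close> orthogonal to all lower degrees, and one more integration by parts makes
  \<open>(t\<^sup>2 - 1) P'\<close> orthogonal to degrees below \<open>n\<close> (\<open>lobatto_orthogonal\<close>).  Dividing by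
  \<open>(t\<^sup>2 - 1) P'\<close> therefore raises the exactness of the interpolatory rule on its \<open>n + 2\<close> zeros from
  \<open>n + 1\<close> to \<open>2n + 1\<close> (\<open>exists_interpolatory_rule\<close>).  The end weights come from the test
  polynomials \<open>(1 \<plusminus> t) P'\<close>, which see a single end point and no interior node; their integrals are
  known from \<open>P(\<plusminus>1)\<close>, and Legendre's differential equation relates these to \<open>P'(\<plusminus>1)\<close>
  (\<open>lobatto_end_moment\<close>).
\<close>

section \<open>Polynomials with prescribed zeros\<close>

definition monic_with_zeros :: "real set \<Rightarrow> real poly" where
  "monic_with_zeros S = (\<Prod>x\<in>S. [:- x, 1:])"

lemma degree_monic_with_zeros [simp]: "degree (monic_with_zeros S) = card S"
proof (cases "finite S")
  case True
  then show ?thesis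
    unfolding monic_with_zeros_def by (subst degree_prod_eq_sum_degree) auto
qed (simp add: monic_with_zeros_def)

lemma poly_monic_with_zeros_eq_0_iff [simp]:
  "finite S \<Longrightarrow> poly (monic_with_zeros S) y = 0 \<longleftrightarrow> y \<in> S"
  by (auto simp: monic_with_zeros_def poly_prod)

lemma poly_eq_if_agree_on_card:
  fixes p q :: "real poly"
  assumes "finite N" "degree p < card N" "degree q < card N" "\<And>x. x \<in> N \<Longrightarrow> poly p x = poly q x"
  shows "p = q"
proof (rule ccontr)
  assume "p \<noteq> q"
  then have nz: "p - q \<noteq> 0" by simp
  have "card N \<le> card {x. poly (p - q) x = 0}"
    by (rule card_mono) (use poly_roots_finite[OF nz] assms(4) in auto)
  also have "\<dots> \<le> degree (p - q)"
    using nz by (rule card_poly_roots_bound)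
  also have "\<dots> < card N"
    using assms(2,3) by (rule degree_diff_less)
  finally show False by simp
qed

text \<open>
  Interpolation on \<open>N\<close> gives a rule that is exact below degree \<open>card N\<close>.  For a larger degree, divide
  \<open>U\<close> by the nodal polynomial \<open>M\<close>: the rule does not see the multiple of \<open>M\<close>, because \<open>M\<close> vanishes
  on \<open>N\<close>, and neither does \<open>I\<close>, by orthogonality.  This is the principle behind all Gauss-type
  quadratures; \<open>d\<close> counts the degrees gained.
\<close>

lemma exists_interpolatory_rule:
  fixes I :: "real poly \<Rightarrow> real"
  assumes add: "\<And>p q. I (p + q) = I p + I q" and smult: "\<And>c p. I (smult c p) = c * I p"
    and N: "finite N" "N \<noteq> {}"
    and M: "degree M = card N" "\<And>x. x \<in> N \<Longrightarrow> poly M x = 0"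
    and orth: "\<And>f. degree f < d \<Longrightarrow> I (f * M) = 0"
  shows "\<exists>w. \<forall>U. degree U < card N + d \<longrightarrow> I U = (\<Sum>x\<in>N. w x * poly U x)"
proof -
  have zero: "I 0 = 0" using smult[of 0 0] by simp
  have I_sum: "I (\<Sum>x\<in>A. g x) = (\<Sum>x\<in>A. I (g x))" for g and A :: "real set"
    by (induction A rule: infinite_finite_induct) (auto simp: zero add)
  define b where "b x = monic_with_zeros (N - {x})" for x
  \<comment> \<open>\<open>b x / b x x\<close> is the Lagrange basis polynomial at \<open>x\<close>, so its weight must be its integral.\<close>
  define w where "w x = I (b x) / poly (b x) x" for x
  have "M \<noteq> 0" using M(1) N by auto
  have low: "I r = (\<Sum>x\<in>N. w x * poly r x)" if r: "degree r < card N" for r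
  proof -
    define q where "q = (\<Sum>x\<in>N. smult (poly r x / poly (b x) x) (b x))"
    have "r = q"
    proof (rule poly_eq_if_agree_on_card[OF N(1) r])
      have "degree q \<le> card N - 1"
        unfolding q_def by (rule degree_sum_le) (use N in \<open>auto simp: b_def\<close>)
      then show "degree q < card N" using r by linarith
      fix y assume y: "y \<in> N"
      have "poly q y = (\<Sum>x\<in>N. if x = y then poly r y else 0)"
        unfolding q_def poly_sum by (rule sum.cong) (use N y in \<open>auto simp: b_def\<close>)
      then show "poly r y = poly q y" using N y by simp
    qed
    then have "I r = (\<Sum>x\<in>N. I (smult (poly r x / poly (b x) x) (b x)))"
      using I_sum unfolding q_def by metis
    then show ?thesis by (simp add: smult w_def mult.commute)
  qed
  have "I U = (\<Sum>x\<in>N. w x * poly U x)" if U: "degree U < card N + d" for U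
  proof -
    define q r where "q = U div M" and "r = U mod M"
    have Uqr: "U = q * M + r" unfolding q_def r_def by simp
    have r: "degree r < card N"
      using degree_mod_less[of M U] \<open>M \<noteq> 0\<close> M(1) N by (auto simp: r_def card_gt_0_iff)
    have "I (q * M) = 0"
    proof (cases "q = 0")
      case False
      then have qM: "degree (q * M) = degree q + card N"
        using \<open>M \<noteq> 0\<close> M(1) by (simp add: degree_mult_eq)
      then have "degree U = degree q + card N"
        unfolding Uqr using r by (subst degree_add_eq_left) auto
      then show ?thesis using U by (intro orth) simp
    qed (simp add: zero)
    then have "I U = I r" using add[of "q * M" r] Uqr by simp
    also have "\<dots> = (\<Sum>x\<in>N. w x * poly U x)"
      unfolding low[OF r] by (rule sum.cong) (auto simp: Uqr M(2))
    finally show ?thesis .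
  qed
  then show ?thesis by blast
qed

section \<open>Integrals of polynomials\<close>

lemma poly_integrable_on [simp]: "poly (p :: real poly) integrable_on {a..b}"
  by (intro integrable_continuous_real continuous_on_poly) (rule continuous_on_id)

lemma integral_poly_add:
  "integral {a..b} (poly (p + q)) = integral {a..b} (poly p) + integral {a..b} (poly (q :: real poly))"
  using integral_add[OF poly_integrable_on[of p a b] poly_integrable_on[of q a b]]
  by (simp add: poly_add[abs_def])

lemma integral_poly_smult:
  "integral {a..b} (poly (smult c p)) = c * integral {a..b} (poly (p :: real poly))"
proof -
  have "poly (smult c p) = (\<lambda>x. c * poly p x)" by auto
  then show ?thesis by simp
qed

lemma integral_poly_pderiv:
  fixes p :: "real poly"
  assumes "a \<le> b"
  shows "integral {a..b} (poly (pderiv p)) = poly p b - poly p a"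
  by (intro integral_unique fundamental_theorem_of_calculus assms)
     (auto simp: has_real_derivative_iff_has_vector_derivative[symmetric]
           intro!: DERIV_subset[OF poly_DERIV])

lemma integral_poly_pos:
  fixes p :: "real poly"
  assumes "a < b" "p \<noteq> 0" "\<And>x. x \<in> {a..b} \<Longrightarrow> 0 \<le> poly p x"
  shows "0 < integral {a..b} (poly p)"
proof -
  have nonneg: "0 \<le> integral {a..b} (poly p)"
    by (rule integral_nonneg) (use assms in auto)
  have "integral {a..b} (poly p) \<noteq> 0"
  proof
    assume "integral {a..b} (poly p) = 0"
    then have z: "poly p x = 0" if "x \<in> {a..b}" for x
      using that assms
      by (subst (asm) integral_eq_0_iff) (auto intro!: continuous_on_poly)
    then have "{a..b} \<subseteq> {x. poly p x = 0}" by auto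
    then have "finite {a..b}" using poly_roots_finite[OF assms(2)] finite_subset by blast
    then show False using \<open>a < b\<close> by (simp add: infinite_Icc)
  qed
  then show ?thesis using nonneg by simp
qed

text \<open>
  The substitution \<open>x = (1 + t) / 2\<close>, which carries the classical interval to the unit interval.
\<close>

lemma integral_poly_rescale:
  fixes U :: "real poly"
  shows "integral {-1..1} (poly (pcompose U [:1/2, 1/2:])) = 2 * integral {0..1} (poly U)"
proof -
  have "(poly U has_integral integral {0..1} (poly U)) (cbox 0 1)"
    using integrable_integral[OF poly_integrable_on[of U 0 1]] by simp
  from has_integral_affinity'[OF this, of "1/2" "1/2"]
  have "((\<lambda>x. poly U (x / 2 + 1 / 2)) has_integral 2 * integral {0..1} (poly U)) {-1..1}"
    by simp
  moreover have "(\<lambda>x. poly U (x / 2 + 1 / 2)) = poly (pcompose U [:1/2, 1/2:])"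
    by (auto simp: poly_pcompose algebra_simps)
  ultimately show ?thesis by (simp add: integral_unique)
qed

section \<open>Optimality of positive rules with few nodes\<close>

text \<open>
  Dropping the nonnegative interior sum bounds every admissible quotient by \<open>W\<^sup>-\<^sup>1\<close>.  The bound
  \<open>2 * card X \<le> k\<close> leaves room for the square \<open>S\<close> that vanishes exactly on \<open>X\<close>; it attains equality,
  and testing a competing rule on \<open>S\<close> confines the competitor's positive weights to \<open>X\<close>.
\<close>

lemma positive_rule_is_optimal:
  assumes rule: "boundary_weighted_rule k X w W"
    and X: "X \<subseteq> {0<..<1}" "2 * card X \<le> k" and pos: "\<forall>x\<in>X. 0 < w x" "0 < W"
  shows "optimal_boundary_weighted_rule k X w W"
    and "optimal_boundary_weighted_rule k Y v V \<Longrightarrow>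
           V = W \<and> {y \<in> Y. v y \<noteq> 0} = X \<and> (\<forall>x\<in>X. v x = w x)"
proof -
  have fin: "finite X"
    and exact: "\<And>U. degree U \<le> k \<Longrightarrow> integral {0..1} (poly U) =
                  (\<Sum>x\<in>X. w x * poly U x) + W * ((poly U 0 + poly U 1) / 2)"
    using rule unfolding boundary_weighted_rule_def by blast+
  define L where "L = monic_with_zeros X"
  define S where "S = L ^ 2"
  have S_zero: "poly S y = 0 \<longleftrightarrow> y \<in> X" and S_nonneg: "0 \<le> poly S y" for y
    using fin by (auto simp: S_def L_def)
  have S_deg: "degree S \<le> k"
    using X(2) order_trans[OF degree_power_le[of L 2], of k] by (simp add: S_def L_def)
  have S_int: "integral {0..1} (poly S) = W * ((poly S 0 + poly S 1) / 2)"
    using exact[OF S_deg] S_zero by (simp add: sum.neutral)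
  have "0 < poly S 0" using X(1) S_zero[of 0] S_nonneg[of 0] by force
  then have S_pos: "0 < (poly S 0 + poly S 1) / 2" using S_nonneg[of 1] by simp
  have opt: "optimal_interior_weight k = ereal (inverse W)"
    unfolding optimal_interior_weight_def
  proof (rule antisym)
    have "(poly U 0 + poly U 1) / 2 / integral {0..1} (poly U) \<le> inverse W"
      if U: "degree U \<le> k" "\<forall>x\<in>{0..1}. 0 \<le> poly U x" "0 < integral {0..1} (poly U)" for U
    proof -
      have "0 \<le> (\<Sum>x\<in>X. w x * poly U x)"
        using X(1) pos(1) U(2) by (intro sum_nonneg mult_nonneg_nonneg) (force intro: less_imp_le)+
      then have "W * ((poly U 0 + poly U 1) / 2) \<le> integral {0..1} (poly U)"
        using exact[OF U(1)] by simp
      then show ?thesis using U(3) pos(2) by (simp add: field_simps)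
    qed
    then show "Sup {ereal ((poly U 0 + poly U 1) / 2 / integral {0..1} (poly U)) |U.
        degree U \<le> k \<and> (\<forall>x\<in>{0..1}. 0 \<le> poly U x) \<and> 0 < integral {0..1} (poly U)}
        \<le> ereal (inverse W)"
      by (intro Sup_least) auto
    have "inverse W = (poly S 0 + poly S 1) / 2 / integral {0..1} (poly S)"
    proof -
      have "inverse W = c / (W * c)" if "0 < c" for c
        using that by (simp add: inverse_eq_divide)
      from this[OF S_pos] show ?thesis unfolding S_int .
    qed
    moreover have "0 < integral {0..1} (poly S)" using S_pos pos(2) unfolding S_int by simp
    ultimately show "ereal (inverse W) \<le>
        Sup {ereal ((poly U 0 + poly U 1) / 2 / integral {0..1} (poly U)) |U.
          degree U \<le> k \<and> (\<forall>x\<in>{0..1}. 0 \<le> poly U x) \<and> 0 < integral {0..1} (poly U)}"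
      using S_deg S_nonneg by (intro Sup_upper) blast
  qed
  show "optimal_boundary_weighted_rule k X w W"
    using rule opt by (simp add: optimal_boundary_weighted_rule_def)
  assume Y: "optimal_boundary_weighted_rule k Y v V"
  have V: "V = W"
    using Y opt by (simp add: optimal_boundary_weighted_rule_def)
  have finY: "finite Y" and v: "\<And>y. y \<in> Y \<Longrightarrow> 0 \<le> v y"
    and exactY: "\<And>U. degree U \<le> k \<Longrightarrow> integral {0..1} (poly U) =
                  (\<Sum>y\<in>Y. v y * poly U y) + W * ((poly U 0 + poly U 1) / 2)"
    using Y V unfolding optimal_boundary_weighted_rule_def boundary_weighted_rule_def by blast+
  have "(\<Sum>y\<in>Y. v y * poly S y) = 0"
    using exactY[OF S_deg] S_int by simp
  then have "v y * poly S y = 0" if "y \<in> Y" for y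
    using that finY v S_nonneg by (subst (asm) sum_nonneg_eq_0_iff) auto
  then have supp: "y \<in> X" if "y \<in> Y" "v y \<noteq> 0" for y
    using that S_zero by auto
  have "x \<in> Y \<and> v x = w x" if x: "x \<in> X" for x
  proof -
    \<comment> \<open>The boundary terms agree, and the interior sums see \<open>l\<close> only at \<open>x\<close>.\<close>
    define l where "l = monic_with_zeros (X - {x})"
    have l: "poly l y = 0 \<longleftrightarrow> y \<in> X - {x}" for y
      using fin by (simp add: l_def)
    have deg: "degree l \<le> k" using X(2) fin x by (simp add: l_def)
    have "(\<Sum>y\<in>Y. v y * poly l y) = (\<Sum>y\<in>X. w y * poly l y)"
      using exact[OF deg] exactY[OF deg] by simp
    also have "\<dots> = (\<Sum>y\<in>X. if y = x then w x * poly l x else 0)"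
      by (rule sum.cong) (use l in auto)
    also have "\<dots> = w x * poly l x" using fin x by simp
    also have "(\<Sum>y\<in>Y. v y * poly l y) = (\<Sum>y\<in>Y. if y = x then v x * poly l x else 0)"
      by (rule sum.cong) (use l supp in auto)
    also have "\<dots> = (if x \<in> Y then v x * poly l x else 0)" using finY by simp
    finally show ?thesis
      using l[of x] pos(1) x by (auto split: if_splits)
  qed
  then show "V = W \<and> {y \<in> Y. v y \<noteq> 0} = X \<and> (\<forall>x\<in>X. v x = w x)"
    using V supp pos(1) by force
qed

section \<open>Rodrigues' formula\<close>

text \<open>
  The intermediate derivatives of Rodrigues' formula: all the properties below are proved by
  induction on the number \<open>k\<close> of derivatives.  The value at \<open>k = m\<close> is the Legendre polynomial up to
  the factor \<open>2\<^sup>m m!\<close>, which affects neither zeros nor orthogonality.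
\<close>

definition rodrigues :: "nat \<Rightarrow> nat \<Rightarrow> real poly" where
  "rodrigues m k = (pderiv ^^ k) ([:-1, 0, 1:] ^ m)"

lemma rodrigues_0: "rodrigues m 0 = [:-1, 0, 1:] ^ m"
  by (simp add: rodrigues_def)

lemma pderiv_rodrigues [simp]: "pderiv (rodrigues m k) = rodrigues m (Suc k)"
  by (simp add: rodrigues_def)

lemma power_dvd_pderiv:
  fixes p q :: "real poly"
  assumes "q ^ Suc j dvd p"
  shows "q ^ j dvd pderiv p"
proof -
  obtain r where "p = q ^ Suc j * r" using assms by (rule dvdE)
  then have "pderiv p = q ^ j * (q * pderiv r + smult (of_nat (Suc j)) (r * pderiv q))"
    by (simp add: pderiv_mult pderiv_power_Suc algebra_simps del: power_Suc) (simp add: algebra_simps)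
  then show ?thesis by simp
qed

text \<open>
  Each derivative lowers the multiplicity \<open>m\<close> of the zeros \<open>\<plusminus>1\<close> by at most one.
\<close>

lemma rodrigues_vanishes_at_ends:
  assumes "k < m" "t\<^sup>2 = 1"
  shows "poly (rodrigues m k) t = 0"
proof -
  have "k \<le> m \<Longrightarrow> [:-1, 0, 1:] ^ (m - k) dvd rodrigues m k"
  proof (induction k)
    case (Suc k)
    then show ?case
      using power_dvd_pderiv[of "[:-1, 0, 1:]" "m - Suc k" "rodrigues m k"]
      by (simp add: Suc_diff_Suc)
  qed (simp add: rodrigues_0)
  then have "[:-1, 0, 1:] dvd rodrigues m k"
    using assms(1) dvd_power[of "m - k" "[:-1, 0, 1:] :: real poly"] dvd_trans by fastforce
  then show ?thesis using assms(2) by (auto elim!: dvdE simp: power2_eq_square)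
qed

lemma degree_rodrigues: "degree (rodrigues m k) = 2 * m - k"
  by (induction k) (auto simp: rodrigues_0 degree_power_eq degree_pderiv pderiv_rodrigues[symmetric]
    simp del: pderiv_rodrigues)

text \<open>
  Induction adds a new largest zero \<open>b\<close>, and Rolle's theorem gives a zero of the derivative between
  the former largest zero and \<open>b\<close>.  It is new because the earlier ones lie below a member of \<open>S\<close>;
  the bounds on both sides also keep the zeros inside any interval that contains \<open>S\<close>.
\<close>

lemma rolle_zeros:
  fixes p :: "real poly"
  assumes "finite S" "\<forall>x\<in>S. poly p x = 0"
  shows "\<exists>T. finite T \<and> card T = card S - 1 \<and>
           (\<forall>t\<in>T. poly (pderiv p) t = 0 \<and> (\<exists>a\<in>S. \<exists>b\<in>S. a < t \<and> t < b))"
  using assms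
proof (induction S rule: finite_linorder_max_induct)
  case (insert b S)
  then obtain T where T: "finite T" "card T = card S - 1"
      "\<forall>t\<in>T. poly (pderiv p) t = 0 \<and> (\<exists>a\<in>S. \<exists>b\<in>S. a < t \<and> t < b)"
    by auto
  show ?case
  proof (cases "S = {}")
    case False
    define a where "a = Max S"
    have a: "a \<in> S" "\<And>x. x \<in> S \<Longrightarrow> x \<le> a" using False insert(1) by (auto simp: a_def)
    have "a < b" using a insert by auto
    then obtain c where c: "a < c" "c < b" "poly p b - poly p a = (b - a) * poly (pderiv p) c"
      using poly_MVT by blast
    have c0: "poly (pderiv p) c = 0" using c insert(4) a \<open>a < b\<close> by auto
    have "c \<notin> T" using T(3) a(2) c(1) by fastforce
    then have "card (insert c T) = card (insert b S) - 1"
      using T insert False by (auto simp: card_gt_0_iff Suc_diff_Suc)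
    moreover have "\<forall>t\<in>insert c T. poly (pderiv p) t = 0 \<and>
        (\<exists>a\<in>insert b S. \<exists>b\<in>insert b S. a < t \<and> t < b)"
      using T(3) c c0 a(1) by blast
    ultimately show ?thesis using T(1) by blast
  qed (intro exI[of _ "{}"], simp)
qed (intro exI[of _ "{}"], simp)

text \<open>
  Before each of the first \<open>m\<close> derivatives, the end points count as two further zeros, so Rolle's
  theorem gains one zero in the open interval instead of losing one.
\<close>

lemma rodrigues_zeros:
  "k \<le> m \<Longrightarrow> \<exists>T. finite T \<and> card T = k \<and> T \<subseteq> {-1<..<1} \<and> (\<forall>t\<in>T. poly (rodrigues m k) t = 0)"
proof (induction k)
  case 0
  show ?case by (intro exI[of _ "{}"]) simp
next
  case (Suc k)
  then obtain T where T: "finite T" "card T = k" "T \<subseteq> {-1<..<1}"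
      "\<forall>t\<in>T. poly (rodrigues m k) t = 0" by auto
  define S where "S = insert (-1) (insert 1 T)"
  have S: "finite S" "S \<subseteq> {-1..1}" using T by (auto simp: S_def)
  have "1 \<notin> T" "-1 \<notin> T" using T(3) by auto
  then have card: "card S = k + 2" using T by (simp add: S_def)
  have "\<forall>x\<in>S. poly (rodrigues m k) x = 0"
    using T Suc.prems rodrigues_vanishes_at_ends[of k m] by (auto simp: S_def)
  from rolle_zeros[OF S(1) this] obtain T' where T': "finite T'" "card T' = card S - 1"
     "\<forall>t\<in>T'. poly (rodrigues m (Suc k)) t = 0 \<and> (\<exists>a\<in>S. \<exists>b\<in>S. a < t \<and> t < b)"
    by auto
  moreover have "T' \<subseteq> {-1<..<1}" using T'(3) S(2) by fastforce
  ultimately show ?case using card by auto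
qed

text \<open>
  Integration by parts moves the \<open>k\<close> derivatives to \<open>f\<close>, which they annihilate; the boundary terms
  vanish because \<open>\<plusminus>1\<close> are zeros of all derivatives of order below \<open>m\<close>.
\<close>

lemma rodrigues_orthogonal:
  "degree f < k \<Longrightarrow> k \<le> m \<Longrightarrow> integral {-1..1} (poly (rodrigues m k * f)) = 0"
proof (induction k arbitrary: f)
  case (Suc k)
  have "integral {-1..1} (poly (pderiv (rodrigues m k * f))) = 0"
    using Suc.prems by (subst integral_poly_pderiv) (auto simp: rodrigues_vanishes_at_ends)
  moreover have "integral {-1..1} (poly (rodrigues m k * pderiv f)) = 0"
  proof (cases "degree f = 0")
    case True
    then have "pderiv f = 0" by (simp add: pderiv_eq_0_iff)
    then show ?thesis by (simp add: poly_0[abs_def])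
  next
    case False
    then show ?thesis using Suc by (intro Suc.IH) (auto simp: degree_pderiv)
  qed
  moreover have "pderiv (rodrigues m k * f) = rodrigues m (Suc k) * f + rodrigues m k * pderiv f"
    by (simp add: pderiv_mult algebra_simps)
  ultimately show ?case
    by (simp only: integral_poly_add)
qed simp

text \<open>
  The function \<open>u = (t\<^sup>2 - 1)\<^sup>m\<close> satisfies \<open>(t\<^sup>2 - 1) u' = 2 m t u\<close>, and this identity is the
  differentiated equation for \<open>k + 1\<close> derivatives.  For \<open>k = m\<close> it is Legendre's differential
  equation.
\<close>

lemma rodrigues_ode:
  "(t\<^sup>2 - 1) * poly (rodrigues m (k + 2)) t
     + 2 * (real k + 1 - real m) * t * poly (rodrigues m (k + 1)) t
     + (real k + 1) * (real k - 2 * real m) * poly (rodrigues m k) t = 0"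
proof -
  have "[:-1, 0, 1:] * rodrigues m (k + 2)
     + [:0, 2 * (real k + 1 - real m):] * rodrigues m (k + 1)
     + smult ((real k + 1) * (real k - 2 * real m)) (rodrigues m k) = 0" (is "?E k = 0")
  proof (induction k)
    case 0
    define u :: "real poly" where "u = [:-1, 0, 1:] ^ m"
    have "[:-1, 0, 1:] * pderiv u = [:0, 2 * real m:] * u"
      unfolding u_def
      by (cases m) (simp_all add: pderiv_power_Suc pderiv_pCons algebra_simps del: power_Suc, simp)
    then have "pderiv ([:-1, 0, 1:] * pderiv u) = pderiv ([:0, 2 * real m:] * u)" by simp
    then have "[:-1, 0, 1:] * pderiv (pderiv u) + [:0, 2:] * pderiv u =
        [:0, 2 * real m:] * pderiv u + smult (2 * real m) u"
      unfolding pderiv_mult by (simp add: pderiv_pCons algebra_simps)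
    moreover have "u = rodrigues m 0" by (simp add: u_def rodrigues_0)
    ultimately show ?case
      by (simp add: numeral_2_eq_2 poly_eq_poly_eq_iff[symmetric] fun_eq_iff algebra_simps)
  next
    case (Suc k)
    then have "pderiv (?E k) = 0" by simp
    then show ?case
      unfolding pderiv_add pderiv_mult pderiv_smult
      by (simp add: pderiv_pCons poly_eq_poly_eq_iff[symmetric] fun_eq_iff algebra_simps)
  qed
  then have "poly (?E k) t = 0" by simp
  then show ?thesis by (simp add: algebra_simps power2_eq_square)
qed

section \<open>The Gauss--Lobatto rule on $[-1, 1]$\<close>

text \<open>
  One last application of Rolle's theorem, now without help from the end points, leaves \<open>n\<close> of the
  \<open>n + 1\<close> zeros; these are all zeros because \<open>n\<close> is the degree.
\<close>

lemma lobatto_zeros: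
  fixes n :: nat
  defines "Z \<equiv> {t. poly (rodrigues (n + 1) (n + 2)) t = 0}"
  shows "finite Z" "card Z = n" "Z \<subseteq> {-1<..<1}"
proof -
  have R: "rodrigues (n + 1) (n + 2) = pderiv (rodrigues (n + 1) (n + 1))" by simp
  have nz: "rodrigues (n + 1) (n + 2) \<noteq> 0"
    unfolding R pderiv_eq_0_iff degree_rodrigues by simp
  obtain T where T: "finite T" "card T = n + 1" "T \<subseteq> {-1<..<1}"
      "\<forall>t\<in>T. poly (rodrigues (n + 1) (n + 1)) t = 0"
    using rodrigues_zeros[of "n + 1" "n + 1"] by blast
  from rolle_zeros[OF T(1,4)] obtain T' where T': "finite T'" "card T' = n"
     "\<forall>t\<in>T'. poly (rodrigues (n + 1) (n + 2)) t = 0 \<and> (\<exists>a\<in>T. \<exists>b\<in>T. a < t \<and> t < b)"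
    using T(2) R by auto
  show fin: "finite Z" unfolding Z_def using nz by (rule poly_roots_finite)
  have "card Z \<le> n"
    using card_poly_roots_bound[OF nz] unfolding Z_def degree_rodrigues by simp
  then have "T' = Z"
    using T' fin by (intro card_seteq) (auto simp: Z_def)
  then show "card Z = n" "Z \<subseteq> {-1<..<1}" using T' T(3) by fastforce+
qed

text \<open>
  With \<open>g = (t\<^sup>2 - 1) f\<close>, integration by parts turns \<open>\<integral>g P'\<close> into \<open>-\<integral>g' P\<close>: the boundary terms
  vanish because \<open>g(\<plusminus>1) = 0\<close>, and \<open>g'\<close> has degree at most \<open>n\<close>, to which \<open>P\<close> is orthogonal.
\<close>

lemma lobatto_orthogonal:
  assumes "degree f < n"
  shows "integral {-1..1} (poly (f * ([:-1, 0, 1:] * rodrigues (n + 1) (n + 2)))) = 0"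
proof -
  define g where "g = f * [:-1, 0, 1:]"
  define P where "P = rodrigues (n + 1) (n + 1)"
  have "degree g \<le> n + 1"
    using assms degree_mult_le[of f "[:-1, 0, 1:]"] unfolding g_def by simp
  then have "degree (pderiv g) < n + 1" by (simp add: degree_pderiv)
  then have "integral {-1..1} (poly (P * pderiv g)) = 0"
    unfolding P_def by (rule rodrigues_orthogonal) simp
  moreover have "integral {-1..1} (poly (pderiv (P * g))) = 0"
    by (subst integral_poly_pderiv) (auto simp: g_def)
  ultimately have "integral {-1..1} (poly (g * pderiv P)) = 0"
    by (simp add: pderiv_mult integral_poly_add)
  moreover have "g * pderiv P = f * ([:-1, 0, 1:] * rodrigues (n + 1) (n + 2))"
    unfolding g_def mult.assoc by (simp add: P_def)
  ultimately show ?thesis by simp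
qed

text \<open>
  Since \<open>P\<close> is orthogonal to the constants, integration by parts gives
  \<open>\<integral>(1 + s t) P' = 2 s P(s)\<close> for \<open>s = \<plusminus>1\<close>, and Legendre's differential equation at the singular
  point \<open>t = s\<close> reduces to \<open>(n + 1) (n + 2) P(s) = 2 s P'(s)\<close>.
\<close>

lemma lobatto_end_moment:
  fixes n :: nat and s :: real
  assumes s: "s\<^sup>2 = 1"
  defines "R \<equiv> rodrigues (n + 1) (n + 2)"
  shows "integral {-1..1} (poly ([:1, s:] * R)) = gauss_lobatto_end_weight n * (2 * poly R s)"
proof -
  define P where "P = rodrigues (n + 1) (n + 1)"
  have R: "pderiv P = R" by (simp add: P_def R_def)
  have "integral {-1..1} (poly (P * 1)) = 0"
    unfolding P_def by (rule rodrigues_orthogonal) auto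
  moreover have "pderiv ([:1, s:] * P) = [:1, s:] * R + smult s P"
    unfolding pderiv_mult R by (simp add: pderiv_pCons)
  ultimately have "integral {-1..1} (poly ([:1, s:] * R)) =
      integral {-1..1} (poly (pderiv ([:1, s:] * P)))"
    by (simp only: integral_poly_add integral_poly_smult) simp
  also have "\<dots> = (1 + s) * poly P 1 - (1 - s) * poly P (-1)"
    by (subst integral_poly_pderiv) (simp_all add: algebra_simps)
  also have "\<dots> = 2 * s * poly P s"
    using s by (auto simp: power2_eq_1_iff)
  also have "2 * s * poly P s = gauss_lobatto_end_weight n * (2 * s\<^sup>2 * poly R s)"
  proof -
    define K where "K = (real n + 1) * (real n + 2)"
    have "K > 0" by (simp add: K_def)
    have "K * poly P s = 2 * s * poly R s"
      using rodrigues_ode[of s "n + 1" "n + 1"] s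
      by (simp add: P_def R_def K_def algebra_simps)
    then have "poly P s = 2 / K * (s * poly R s)"
      using \<open>K > 0\<close> by (simp add: field_simps)
    moreover have "gauss_lobatto_end_weight n = 2 / K"
      by (simp add: gauss_lobatto_end_weight_def K_def)
    ultimately show ?thesis by (simp add: power2_eq_square)
  qed
  finally show ?thesis using s by simp
qed

text \<open>
  The rule comes from \<open>exists_interpolatory_rule\<close>, with \<open>(t\<^sup>2 - 1) P'\<close> as nodal polynomial.  The
  values of the end weights and the signs of the other weights come from integrating, for each
  node, a polynomial that vanishes at all the others.
\<close>

lemma lobatto_rule:
  fixes n :: nat
  defines "Z \<equiv> {t. poly (rodrigues (n + 1) (n + 2)) t = 0}"
  shows "\<exists>w. (\<forall>x\<in>Z. 0 < w x) \<and> (\<forall>U. degree U \<le> 2 * n + 1 \<longrightarrow>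
     integral {-1..1} (poly U) =
       gauss_lobatto_end_weight n * (poly U (-1) + poly U 1) + (\<Sum>x\<in>Z. w x * poly U x))"
proof -
  note Z = lobatto_zeros[of n, folded Z_def]
  define R where "R = rodrigues (n + 1) (n + 2)"
  have R_zero: "poly R t = 0 \<longleftrightarrow> t \<in> Z" for t by (simp add: R_def Z_def)
  have R_deg: "degree R = n" by (simp add: R_def degree_rodrigues)
  have ends: "1 \<notin> Z" "-1 \<notin> Z" using Z(3) by auto
  then have "R \<noteq> 0" using R_zero[of 1] by auto
  define N where "N = insert (-1) (insert 1 Z)"
  have N: "finite N" "N \<noteq> {}" "card N = n + 2" using Z ends by (auto simp: N_def)
  have M: "degree ([:-1, 0, 1:] * R) = card N"
    using \<open>R \<noteq> 0\<close> R_deg N(3) by (subst degree_mult_eq) auto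
  have M0: "poly ([:-1, 0, 1:] * R) x = 0" if "x \<in> N" for x
    using that by (auto simp: N_def R_zero)
  have "\<exists>w. \<forall>U. degree U < card N + n \<longrightarrow> integral {-1..1} (poly U) = (\<Sum>x\<in>N. w x * poly U x)"
  proof (rule exists_interpolatory_rule[OF integral_poly_add integral_poly_smult N(1,2) M M0])
    show "integral {-1..1} (poly (f * ([:-1, 0, 1:] * R))) = 0" if "degree f < n" for f
      unfolding R_def using that by (rule lobatto_orthogonal)
  qed
  then obtain w where w0: "\<And>U. degree U < card N + n \<Longrightarrow>
      integral {-1..1} (poly U) = (\<Sum>x\<in>N. w x * poly U x)" by blast
  have w: "integral {-1..1} (poly U) =
      w (-1) * poly U (-1) + w 1 * poly U 1 + (\<Sum>x\<in>Z. w x * poly U x)"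
    if "degree U \<le> 2 * n + 1" for U
    using w0[of U] that N(3) Z(1) ends by (simp add: N_def)
  have end_weight: "w s = gauss_lobatto_end_weight n" if s: "s = 1 \<or> s = -1" for s
  proof -
    have "s \<noteq> 0" using s by auto
    have deg: "degree ([:1, s:] * R) \<le> 2 * n + 1"
      using R_deg \<open>R \<noteq> 0\<close> \<open>s \<noteq> 0\<close> by (subst degree_mult_eq) auto
    have "(\<Sum>x\<in>Z. w x * poly ([:1, s:] * R) x) = 0"
      by (rule sum.neutral) (simp add: R_zero[THEN iffD2])
    then have "integral {-1..1} (poly ([:1, s:] * R)) =
        w (-1) * ((1 - s) * poly R (-1)) + w 1 * ((1 + s) * poly R 1)"
      unfolding w[OF deg] by (simp add: algebra_simps)
    also have "\<dots> = w s * (2 * poly R s)" using s by (elim disjE) simp_all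
    finally have "integral {-1..1} (poly ([:1, s:] * R)) = w s * (2 * poly R s)" .
    moreover have "integral {-1..1} (poly ([:1, s:] * R)) =
        gauss_lobatto_end_weight n * (2 * poly R s)"
      unfolding R_def by (rule lobatto_end_moment) (use s in auto)
    moreover have "poly R s \<noteq> 0" using R_zero ends s by auto
    ultimately show ?thesis by simp
  qed
  have "0 < w x" if x: "x \<in> Z" for x
  proof -
    \<comment> \<open>Nonnegative, of degree at most \<open>2n\<close>, and nonzero at no node other than \<open>x\<close>.\<close>
    define U where "U = [:1, 0, -1:] * monic_with_zeros (Z - {x}) ^ 2"
    have U_eq: "poly U y = (1 - y\<^sup>2) * (poly (monic_with_zeros (Z - {x})) y)\<^sup>2" for y
      by (simp add: U_def power2_eq_square algebra_simps)
    have "-1 < x" "x < 1" using x Z(3) by (auto simp only: subset_iff greaterThanLessThan_iff)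
    then have "x\<^sup>2 < 1" by (simp add: abs_square_less_1)
    then have Ux: "0 < poly U x" using Z(1) by (simp add: U_eq)
    have "degree (monic_with_zeros (Z - {x}) ^ 2) \<le> (n - 1) * 2"
      using degree_power_le[of "monic_with_zeros (Z - {x})" 2] x Z by simp
    moreover have "0 < n" using x Z by (auto simp: card_gt_0_iff)
    ultimately have deg: "degree U \<le> 2 * n + 1"
      unfolding U_def by (intro order_trans[OF degree_mult_le]) simp
    have "0 < integral {-1..1} (poly U)"
    proof (rule integral_poly_pos)
      show "U \<noteq> 0" using Ux by auto
      show "0 \<le> poly U y" if "y \<in> {-1..1}" for y
        using that by (auto simp: U_eq abs_square_le_1 intro!: mult_nonneg_nonneg)
    qed simp
    also have "\<dots> = (\<Sum>y\<in>Z. w y * poly U y)" using w[OF deg] by (simp add: U_eq)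
    also have "\<dots> = (\<Sum>y\<in>Z. if y = x then w x * poly U x else 0)"
      by (rule sum.cong) (use Z(1) in \<open>auto simp: U_eq\<close>)
    also have "\<dots> = w x * poly U x" using x Z(1) by simp
    finally show ?thesis using Ux by (simp add: zero_less_mult_iff)
  qed
  then show ?thesis
    using w by (intro exI[of _ w]) (simp add: end_weight distrib_left)
qed

section \<open>The Gauss--Lobatto rule on $[0, 1]$\<close>

lemma gauss_lobatto_interior_points_eq:
  "gauss_lobatto_interior_points n =
     (\<lambda>t. (1 + t) / 2) ` {t. poly (rodrigues (n + 1) (n + 2)) t = 0}"
  by (auto simp: gauss_lobatto_interior_points_def legendre_poly_def pderiv_smult rodrigues_def)

lemma gauss_lobatto_interior_points:
  "finite (gauss_lobatto_interior_points n)"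
  "card (gauss_lobatto_interior_points n) = n"
  "gauss_lobatto_interior_points n \<subseteq> {0<..<1}"
proof -
  note Z = lobatto_zeros[of n]
  show "finite (gauss_lobatto_interior_points n)"
    unfolding gauss_lobatto_interior_points_eq using Z(1) by (rule finite_imageI)
  show "card (gauss_lobatto_interior_points n) = n"
    unfolding gauss_lobatto_interior_points_eq
    by (subst card_image) (use Z(2) in \<open>auto simp: inj_on_def\<close>)
  show "gauss_lobatto_interior_points n \<subseteq> {0<..<1}"
    unfolding gauss_lobatto_interior_points_eq using Z(3) by force
qed

lemma gauss_lobatto_rule:
  "\<exists>w. (\<forall>x\<in>gauss_lobatto_interior_points n. 0 < w x) \<and>
     (\<forall>U. degree U \<le> 2 * n + 1 \<longrightarrow>
         2 * integral {0..1} (poly U) =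
           gauss_lobatto_end_weight n * (poly U 0 + poly U 1) +
           (\<Sum>x\<in>gauss_lobatto_interior_points n. w x * poly U x))"
proof -
  define Z where "Z = {t. poly (rodrigues (n + 1) (n + 2)) t = 0}"
  obtain w where w: "\<And>x. x \<in> Z \<Longrightarrow> 0 < w x" "\<And>U. degree U \<le> 2 * n + 1 \<Longrightarrow>
     integral {-1..1} (poly U) =
       gauss_lobatto_end_weight n * (poly U (-1) + poly U 1) + (\<Sum>x\<in>Z. w x * poly U x)"
    using lobatto_rule[of n] unfolding Z_def by blast
  have G: "gauss_lobatto_interior_points n = (\<lambda>t. (1 + t) / 2) ` Z"
    unfolding Z_def by (rule gauss_lobatto_interior_points_eq)
  have "2 * integral {0..1} (poly U) =
           gauss_lobatto_end_weight n * (poly U 0 + poly U 1) +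
           (\<Sum>x\<in>gauss_lobatto_interior_points n. w (2 * x - 1) * poly U x)"
    if "degree U \<le> 2 * n + 1" for U
  proof -
    have "inj_on (\<lambda>t::real. (1 + t) / 2) Z" by (auto simp: inj_on_def)
    then show ?thesis
      using w(2)[of "pcompose U [:1/2, 1/2:]"] that unfolding integral_poly_rescale G
      by (simp add: sum.reindex poly_pcompose degree_pcompose add_divide_distrib)
  qed
  then show ?thesis
    using w(1) by (intro exI[of _ "\<lambda>x. w (2 * x - 1)"]) (auto simp: G add_divide_distrib)
qed

theorem theorem6p11:
  fixes n :: nat
  shows "optimal_interior_weight (2 * n) = ereal ((real n + 1) * (real n + 2) / 2) \<and>
    optimal_interior_weight (2 * n + 1) = ereal ((real n + 1) * (real n + 2) / 2) \<and>
    finite (gauss_lobatto_interior_points n) \<and>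
    card (gauss_lobatto_interior_points n) = n \<and>
    gauss_lobatto_interior_points n \<subseteq> {0<..<1} \<and>
    (\<exists>w :: real \<Rightarrow> real.
      (\<forall>x\<in>gauss_lobatto_interior_points n. 0 < w x) \<and>
      (\<forall>U :: real poly. degree U \<le> 2 * n + 1 \<longrightarrow>
         2 * integral {0..1} (poly U) =
           gauss_lobatto_end_weight n * (poly U 0 + poly U 1) +
           (\<Sum>x\<in>gauss_lobatto_interior_points n. w x * poly U x)) \<and>
      (\<forall>k\<in>{2 * n, 2 * n + 1}.
         optimal_boundary_weighted_rule k (gauss_lobatto_interior_points n) (\<lambda>x. w x / 2)
           (gauss_lobatto_end_weight n) \<and>
         (\<forall>Y v W. optimal_boundary_weighted_rule k Y v W \<longrightarrow>
            W = gauss_lobatto_end_weight n \<and>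
            {y \<in> Y. v y \<noteq> 0} = gauss_lobatto_interior_points n \<and>
            (\<forall>x\<in>gauss_lobatto_interior_points n. v x = w x / 2))))"
proof -
  let ?G = "gauss_lobatto_interior_points n" and ?W = "gauss_lobatto_end_weight n"
  note G = gauss_lobatto_interior_points[of n]
  have W: "0 < ?W" "inverse ?W = (real n + 1) * (real n + 2) / 2"
    by (auto simp: gauss_lobatto_end_weight_def)
  obtain w where w: "\<forall>x\<in>?G. 0 < w x" and exact: "\<forall>U. degree U \<le> 2 * n + 1 \<longrightarrow>
         2 * integral {0..1} (poly U) =
           ?W * (poly U 0 + poly U 1) + (\<Sum>x\<in>?G. w x * poly U x)"
    using gauss_lobatto_rule by blast
  have half: "\<forall>x\<in>?G. 0 < w x / 2" using w by simp
  have rule: "boundary_weighted_rule k ?G (\<lambda>x. w x / 2) ?W" if k: "k \<in> {2 * n, 2 * n + 1}" for k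
    unfolding boundary_weighted_rule_def
  proof (intro conjI allI impI)
    fix U :: "real poly"
    assume "degree U \<le> k"
    then have "2 * integral {0..1} (poly U) =
        ?W * (poly U 0 + poly U 1) + (\<Sum>x\<in>?G. w x * poly U x)"
      using exact k by auto
    moreover have "(\<Sum>x\<in>?G. w x * poly U x) = 2 * (\<Sum>x\<in>?G. w x / 2 * poly U x)"
      by (simp add: sum_distrib_left)
    ultimately show "integral {0..1} (poly U) =
        (\<Sum>x\<in>?G. w x / 2 * poly U x) + ?W * ((poly U 0 + poly U 1) / 2)"
      by (simp add: field_simps)
  next
    show "\<forall>x\<in>?G. 0 \<le> w x / 2" using half by (auto intro: less_imp_le)
    show "?G \<subseteq> {0..1}" using G(3) by (auto simp: subset_iff intro: less_imp_le)
  qed (fact G(1))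
  have deg: "2 * card ?G \<le> k" if "k \<in> {2 * n, 2 * n + 1}" for k using that G(2) by auto
  note opt = positive_rule_is_optimal[OF rule G(3) deg half W(1)]
  have weight: "optimal_interior_weight k = ereal ((real n + 1) * (real n + 2) / 2)"
    if "k \<in> {2 * n, 2 * n + 1}" for k
    using opt(1)[OF that that] W(2) by (simp add: optimal_boundary_weighted_rule_def)
  show ?thesis
  proof (intro conjI exI[of _ w])
    show "optimal_interior_weight (2 * n) = ereal ((real n + 1) * (real n + 2) / 2)"
      and "optimal_interior_weight (2 * n + 1) = ereal ((real n + 1) * (real n + 2) / 2)"
      by (rule weight, simp)+
  next
    show "\<forall>k\<in>{2 * n, 2 * n + 1}.
         optimal_boundary_weighted_rule k ?G (\<lambda>x. w x / 2) ?W \<and>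
         (\<forall>Y v W. optimal_boundary_weighted_rule k Y v W \<longrightarrow>
            W = ?W \<and> {y \<in> Y. v y \<noteq> 0} = ?G \<and> (\<forall>x\<in>?G. v x = w x / 2))"
    proof (intro ballI conjI)
      fix k assume k: "k \<in> {2 * n, 2 * n + 1}"
      show "optimal_boundary_weighted_rule k ?G (\<lambda>x. w x / 2) ?W"
        by (rule opt(1)[OF k k])
      show "\<forall>Y v W. optimal_boundary_weighted_rule k Y v W \<longrightarrow>
            W = ?W \<and> {y \<in> Y. v y \<noteq> 0} = ?G \<and> (\<forall>x\<in>?G. v x = w x / 2)"
        by (intro allI impI) (rule opt(2)[OF k k])
    qed
  qed (fact G w exact)+
qed

end
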